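(* Let $(S,\triangleright)$ and $(T,\triangleright)$ be left shelves and let $r_S$ and $r_T$ be the solutions associated with them, i.e. $r_S(a,b)=(b,\,b\triangleright a)$ and $r_T(u,v)=(v,\,v\triangleright u)$. If $(r_S,r_T,\alpha,\beta)$ is a matched product system of solutions, then the structure shelf operation of the matched product solution $r:=r_S\bowtie r_T$ is $$(a,u)\triangleright_{r}(b,v)=(a\triangleright b,\ u\triangleright v)$$ for all $a,b\in S$ and $u,v\in T$.
   Context: Solutions. A (set-theoretical) solution on a set $X$ is a map $r:X\times X\to X\times X$ with $(r\times\mathrm{id}_X)(\mathrm{id}_X\times r)(r\times\mathrm{id}_X)=(\mathrm{id}_X\times r)(r\times\mathrm{id}_X)(\mathrm{id}_X\times r)$. Write $r(x,y)=(\lambda_x(y),\rho_y(x))$. The solution $r$ is left non-degenerate if every $\lambda_x$ is bijective. Left shelves. A left shelf is a set $X$ with a binary operation $\triangleright$ such that $x\triangleright(y\triangleright z)=(x\triangleright y)\triangleright(x\triangleright z)$ for all $x,y,z\in X$. The solution associated with it is $r_\triangleright(x,y)=(y,\,y\triangleright x)$. Structure shelf. If $r$ is a left non-degenerate solution on $X$, its structure shelf is $X$ with the operation $x\triangleright_r y:=\lambda_x\big(\rho_{\lambda_y^{-1}(x)}(y)\big)$. (In the present situation the matched product solution is left non-degenerate, so this applies.) $\mathrm{Sym}(X)$ is the group of bijections $X\to X$; juxtaposition of maps is composition, $fg=f\circ g$. Matched product systems. Given solutions $r_S$ on $S$ and $r_T$ on $T$ (components of both written $\lambda,\rho$, with $a,b\in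 S$ and $u,v\in T$) and maps $\alpha:T\to\mathrm{Sym}(S)$, $\beta:S\to\mathrm{Sym}(T)$, with $\alpha_u:=\alpha(u)$, $\beta_a:=\beta(a)$, the quadruple $(r_S,r_T,\alpha,\beta)$ is a matched product system of solutions if for all $a,b\in S$, $u,v\in T$: (s1) $\alpha_u\alpha_v=\alpha_{\lambda_u(v)}\alpha_{\rho_v(u)}$; (s2) $\beta_a\beta_b=\beta_{\lambda_a(b)}\beta_{\rho_b(a)}$; (s3) $\rho_{\alpha_u^{-1}(b)}\big(\alpha^{-1}_{\beta_a(u)}(a)\big)=\alpha^{-1}_{\beta_{\rho_b(a)}\beta_b^{-1}(u)}\big(\rho_b(a)\big)$; (s4) $\rho_{\beta_a^{-1}(v)}\big(\beta^{-1}_{\alpha_u(a)}(u)\big)=\beta^{-1}_{\alpha_{\rho_v(u)}\alpha_v^{-1}(a)}\big(\rho_v(u)\big)$; (s5) $\lambda_a\alpha_{\beta_a^{-1}(u)}=\alpha_u\lambda_{\alpha_u^{-1}(a)}$; (s6) $\lambda_u\beta_{\alpha_u^{-1}(a)}=\beta_a\lambda_{\beta_a^{-1}(u)}$. Matched product. For a matched product system, the matched product solution $r_S\bowtie r_T$ is the map on $(S\times T)\times(S\times T)$ (known to be a solution on $S\times T$) $$\big((a,u),(b,v)\big)\mapsto\Big(\big(A,U\big),\ \big(\alpha^{-1}_{\overline U}(\rho_{\alpha_{\bar u}(b)}(a)),\ \beta^{-1}_{\overline A}(\rho_{\beta_{\bar a}(v)}(u))\big)\Big),$$ where $\bar a=\alpha_u^{-1}(a)$,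 $\bar u=\beta_a^{-1}(u)$, $A=\alpha_u(\lambda_{\bar a}(b))$, $U=\beta_a(\lambda_{\bar u}(v))$, $\overline A=\alpha_U^{-1}(A)$, $\overline U=\beta_A^{-1}(U)$. *)

theory Defs
  imports Main
begin

section \<open>Set-theoretical solutions of the Yang--Baxter equation\<close>

text \<open>The underlying set of a solution or of a shelf is the universe of a type.\<close>

definition lam :: "('a \<times> 'a \<Rightarrow> 'a \<times> 'a) \<Rightarrow> 'a \<Rightarrow> 'a \<Rightarrow> 'a"
  where "lam r x y = fst (r (x, y))"

text \<open>The subscript of \<open>\<rho>\<^sub>y(x)\<close> is the second argument of the solution:
  \<open>r (x, y) = (lam r x y, rho r y x)\<close>.\<close>

definition rho :: "('a \<times> 'a \<Rightarrow> 'a \<times> 'a) \<Rightarrow> 'a \<Rightarrow> 'a \<Rightarrow> 'a"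
  where "rho r y x = snd (r (x, y))"

definition apply12 :: "('a \<times> 'a \<Rightarrow> 'a \<times> 'a) \<Rightarrow> 'a \<times> 'a \<times> 'a \<Rightarrow> 'a \<times> 'a \<times> 'a"
  where "apply12 r = (\<lambda>(x, y, z). (fst (r (x, y)), snd (r (x, y)), z))"

definition apply23 :: "('a \<times> 'a \<Rightarrow> 'a \<times> 'a) \<Rightarrow> 'a \<times> 'a \<times> 'a \<Rightarrow> 'a \<times> 'a \<times> 'a"
  where "apply23 r = (\<lambda>(x, y, z). (x, r (y, z)))"

definition solution :: "('a \<times> 'a \<Rightarrow> 'a \<times> 'a) \<Rightarrow> bool"
  where "solution r \<longleftrightarrow>
    apply12 r \<circ> apply23 r \<circ> apply12 r = apply23 r \<circ> apply12 r \<circ> apply23 r"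

definition left_nondegenerate :: "('a \<times> 'a \<Rightarrow> 'a \<times> 'a) \<Rightarrow> bool"
  where "left_nondegenerate r \<longleftrightarrow> (\<forall>x. bij (lam r x))"


section \<open>Left shelves\<close>

definition left_shelf :: "('a \<Rightarrow> 'a \<Rightarrow> 'a) \<Rightarrow> bool"
  where "left_shelf tr \<longleftrightarrow> (\<forall>x y z. tr x (tr y z) = tr (tr x y) (tr x z))"

definition shelf_solution :: "('a \<Rightarrow> 'a \<Rightarrow> 'a) \<Rightarrow> 'a \<times> 'a \<Rightarrow> 'a \<times> 'a"
  where "shelf_solution tr = (\<lambda>(x, y). (y, tr y x))"

text \<open>The following operation is meaningful only for left non-degenerate solutions \<open>r\<close>,
  where \<open>inv\<close> is the two-sided inverse of \<open>\<lambda>\<^sub>y\<close>.\<close>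

definition structure_shelf :: "('a \<times> 'a \<Rightarrow> 'a \<times> 'a) \<Rightarrow> 'a \<Rightarrow> 'a \<Rightarrow> 'a"
  where "structure_shelf r x y = lam r x (rho r (inv (lam r y) x) y)"


section \<open>Matched products\<close>

text \<open>Maps into a symmetric group are families of functions all of which are bijective.\<close>

locale matched_product_system =
  fixes rS :: "'s \<times> 's \<Rightarrow> 's \<times> 's"
    and rT :: "'t \<times> 't \<Rightarrow> 't \<times> 't"
    and \<alpha> :: "'t \<Rightarrow> 's \<Rightarrow> 's"
    and \<beta> :: "'s \<Rightarrow> 't \<Rightarrow> 't"
  assumes solution_S: "solution rS"
    and solution_T: "solution rT"
    and bij_\<alpha>: "bij (\<alpha> u)"
    and bij_\<beta>: "bij (\<beta> a)"
    and s1: "\<alpha> u \<circ> \<alpha> v = \<alpha> (lam rT u v) \<circ> \<alpha> (rho rT v u)"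
    and s2: "\<beta> a \<circ> \<beta> b = \<beta> (lam rS a b) \<circ> \<beta> (rho rS b a)"
    and s3: "rho rS (inv (\<alpha> u) b) (inv (\<alpha> (\<beta> a u)) a)
             = inv (\<alpha> (\<beta> (rho rS b a) (inv (\<beta> b) u))) (rho rS b a)"
    and s4: "rho rT (inv (\<beta> a) v) (inv (\<beta> (\<alpha> u a)) u)
             = inv (\<beta> (\<alpha> (rho rT v u) (inv (\<alpha> v) a))) (rho rT v u)"
    and s5: "lam rS a \<circ> \<alpha> (inv (\<beta> a) u) = \<alpha> u \<circ> lam rS (inv (\<alpha> u) a)"
    and s6: "lam rT u \<circ> \<beta> (inv (\<alpha> u) a) = \<beta> a \<circ> lam rT (inv (\<beta> a) u)"

definition matched_product ::
    "('s \<times> 's \<Rightarrow> 's \<times> 's) \<Rightarrow> ('t \<times> 't \<Rightarrow> 't \<times> 't) \<Rightarrow> ('t \<Rightarrow> 's \<Rightarrow> 's) \<Rightarrow> ('s \<Rightarrow> 't \<Rightarrow> 't)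
      \<Rightarrow> ('s \<times> 't) \<times> ('s \<times> 't) \<Rightarrow> ('s \<times> 't) \<times> ('s \<times> 't)"
  where "matched_product rS rT \<alpha> \<beta> = (\<lambda>((a, u), (b, v)).
    let a_bar = inv (\<alpha> u) a;
        u_bar = inv (\<beta> a) u;
        A = \<alpha> u (lam rS a_bar b);
        U = \<beta> a (lam rT u_bar v);
        A_bar = inv (\<alpha> U) A;
        U_bar = inv (\<beta> A) U
    in ((A, U),
        (inv (\<alpha> U_bar) (rho rS (\<alpha> u_bar b) a),
         inv (\<beta> A_bar) (rho rT (\<beta> a_bar v) u))))"

lemma solution_shelf_solution: "left_shelf tr \<Longrightarrow> solution (shelf_solution tr)"
  by (auto simp: solution_def left_shelf_def shelf_solution_def apply12_def apply23_def fun_eq_iff)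

lemma left_nondegenerate_shelf_solution: "left_nondegenerate (shelf_solution tr)"
  by (simp add: left_nondegenerate_def shelf_solution_def lam_def bij_def inj_on_def surj_def)

lemma (in matched_product_system) left_nondegenerate_matched_product:
  assumes "left_nondegenerate rS" "left_nondegenerate rT"
  shows "left_nondegenerate (matched_product rS rT \<alpha> \<beta>)"
proof -
  have "bij (lam (matched_product rS rT \<alpha> \<beta>) (a, u))" for a u
  proof -
    let ?f = "\<alpha> u \<circ> lam rS (inv (\<alpha> u) a)" and ?g = "\<beta> a \<circ> lam rT (inv (\<beta> a) u)"
    have eq: "lam (matched_product rS rT \<alpha> \<beta>) (a, u) = map_prod ?f ?g"
      by (auto simp: fun_eq_iff lam_def matched_product_def Let_def)
    have "bij ?f" "bij ?g"
      using assms bij_\<alpha> bij_\<beta> by (simp_all add: bij_comp left_nondegenerate_def)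
    then have "bij (map_prod ?f ?g)"
      by (simp add: bij_def prod.inj_map map_prod_surj)
    then show ?thesis
      by (simp only: eq)
  qed
  then show ?thesis
    unfolding left_nondegenerate_def by auto
qed

end

theory Submission
  imports Defs
begin

text \<open>For a shelf solution every \<open>\<lambda>\<^sub>x\<close> is the identity. With trivial \<open>\<lambda>\<close> the conditions (s5) and (s6) collapse to
  \<open>\<alpha>\<^bsub>\<beta>\<^sub>a(u)\<^esub> = \<alpha>\<^sub>u\<close> and \<open>\<beta>\<^bsub>\<alpha>\<^sub>u(a)\<^esub> = \<beta>\<^sub>a\<close> (lemmas \<open>\<alpha>_invariant\<close> and \<open>\<beta>_invariant\<close>), so the
  bars in the matched product formula do not affect which member of \<open>\<alpha>\<close> or \<open>\<beta>\<close> is meant. Hence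
  \<open>\<lambda>\<^bsub>(a,u)\<^esub> = \<alpha>\<^sub>u \<times> \<beta>\<^sub>a\<close>, and the first component of \<open>\<rho>\<^bsub>(c,w)\<^esub>(b,v)\<close> becomes
  \<open>\<alpha>\<^sub>w\<^sup>-\<^sup>1 (\<alpha>\<^sub>v(c) \<triangleright> b)\<close>. In the structure shelf \<open>(c,w) = (\<alpha>\<^sub>v\<^sup>-\<^sup>1(a), \<beta>\<^sub>b\<^sup>-\<^sup>1(u))\<close>. The inner twist
  therefore restores \<open>a\<close>; since also \<open>\<alpha>\<^sub>w = \<alpha>\<^sub>u\<close>, the final application of \<open>\<lambda>\<^bsub>(a,u)\<^esub>\<close> cancels the
  outer one and leaves \<open>a \<triangleright> b\<close>. The second component is symmetric.\<close>

lemma lam_shelf_solution: "lam (shelf_solution tr) x = id"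
  by (simp add: fun_eq_iff lam_def shelf_solution_def)

lemma rho_shelf_solution: "rho (shelf_solution tr) y x = tr y x"
  by (simp add: rho_def shelf_solution_def)

context matched_product_system
begin

lemma \<alpha>_inv_cancel: "\<alpha> u (inv (\<alpha> u) a) = a" "inv (\<alpha> u) (\<alpha> u a) = a"
  using bij_\<alpha>[of u] by (simp_all add: bij_is_surj surj_f_inv_f bij_is_inj)

lemma \<beta>_inv_cancel: "\<beta> a (inv (\<beta> a) u) = u" "inv (\<beta> a) (\<beta> a u) = u"
  using bij_\<beta>[of a] by (simp_all add: bij_is_surj surj_f_inv_f bij_is_inj)

text \<open>Condition (s5) intertwines the maps \<open>\<lambda>\<close> of \<open>r\<^sub>S\<close> with \<open>\<alpha>\<close>; when they are identities it compares
  only the two members of \<open>\<alpha>\<close>. The form with \<open>\<beta>\<close> in place of its inverse follows on replacing \<open>u\<close>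
  by \<open>\<beta>\<^sub>a(u)\<close>. Both forms are needed, because the matched product twists its indices by inverses
  and its values by the maps themselves.\<close>

lemma \<alpha>_invariant:
  assumes "\<And>x. lam rS x = id"
  shows "\<alpha> (inv (\<beta> a) u) = \<alpha> u" and "\<alpha> (\<beta> a u) = \<alpha> u"
proof -
  have inv_eq: "\<alpha> (inv (\<beta> a) w) = \<alpha> w" for w
    using s5[of a w] by (simp add: assms)
  show "\<alpha> (inv (\<beta> a) u) = \<alpha> u"
    by (rule inv_eq)
  show "\<alpha> (\<beta> a u) = \<alpha> u"
    using inv_eq[of "\<beta> a u"] by (simp add: \<beta>_inv_cancel)
qed

lemma \<beta>_invariant:
  assumes "\<And>w. lam rT w = id"
  shows "\<beta> (inv (\<alpha> u) a) = \<beta> a" and "\<beta> (\<alpha> u a) = \<beta> a"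
proof -
  have inv_eq: "\<beta> (inv (\<alpha> u) x) = \<beta> x" for x
    using s6[of u x] by (simp add: assms)
  show "\<beta> (inv (\<alpha> u) a) = \<beta> a"
    by (rule inv_eq)
  show "\<beta> (\<alpha> u a) = \<beta> a"
    using inv_eq[of "\<alpha> u a"] by (simp add: \<alpha>_inv_cancel)
qed

lemma matched_product_trivial_lam:
  assumes "\<And>x. lam rS x = id" and "\<And>w. lam rT w = id"
  shows "matched_product rS rT \<alpha> \<beta> ((a, u), (b, v)) =
    ((\<alpha> u b, \<beta> a v),
     (inv (\<alpha> v) (rho rS (\<alpha> u b) a), inv (\<beta> b) (rho rT (\<beta> a v) u)))"
  by (simp add: matched_product_def Let_def assms \<alpha>_invariant \<beta>_invariant)

lemma inv_lam_matched_product_trivial_lam: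
  assumes "\<And>x. lam rS x = id" and "\<And>w. lam rT w = id"
  shows "inv (lam (matched_product rS rT \<alpha> \<beta>) (b, v)) (a, u) = (inv (\<alpha> v) a, inv (\<beta> b) u)"
proof (rule inv_f_eq)
  have "left_nondegenerate (matched_product rS rT \<alpha> \<beta>)"
    by (rule left_nondegenerate_matched_product) (simp_all add: left_nondegenerate_def assms)
  then show "inj (lam (matched_product rS rT \<alpha> \<beta>) (b, v))"
    by (simp add: left_nondegenerate_def bij_is_inj)
  show "lam (matched_product rS rT \<alpha> \<beta>) (b, v) (inv (\<alpha> v) a, inv (\<beta> b) u) = (a, u)"
    by (simp add: lam_def matched_product_trivial_lam assms \<alpha>_inv_cancel \<beta>_inv_cancel)
qed

text \<open>The outer twist in the first component is \<open>\<alpha>\<close> at \<open>w = \<beta>\<^sub>b\<^sup>-\<^sup>1(u)\<close>, which is \<open>\<alpha>\<^sub>u\<close> by invariance;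
  this is why it cancels against \<open>\<lambda>\<^bsub>(a,u)\<^esub>\<close> although \<open>w\<close> and \<open>u\<close> differ.\<close>

lemma structure_shelf_matched_product_trivial_lam:
  assumes "\<And>x. lam rS x = id" and "\<And>w. lam rT w = id"
  shows "structure_shelf (matched_product rS rT \<alpha> \<beta>) (a, u) (b, v) = (rho rS a b, rho rT u v)"
proof -
  let ?r = "matched_product rS rT \<alpha> \<beta>"
  have "rho ?r (inv (lam ?r (b, v)) (a, u)) (b, v) =
      (inv (\<alpha> u) (rho rS a b), inv (\<beta> a) (rho rT u v))"
    unfolding inv_lam_matched_product_trivial_lam[OF assms] rho_def[of ?r]
      matched_product_trivial_lam[OF assms]
    by (simp add: assms \<alpha>_invariant \<beta>_invariant \<alpha>_inv_cancel \<beta>_inv_cancel)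
  then show ?thesis
    by (simp add: structure_shelf_def lam_def[of ?r] matched_product_trivial_lam assms
        \<alpha>_inv_cancel \<beta>_inv_cancel)
qed

end

theorem proposition4:
  fixes trS :: "'s \<Rightarrow> 's \<Rightarrow> 's"
    and trT :: "'t \<Rightarrow> 't \<Rightarrow> 't"
    and \<alpha> :: "'t \<Rightarrow> 's \<Rightarrow> 's"
    and \<beta> :: "'s \<Rightarrow> 't \<Rightarrow> 't"
  assumes "left_shelf trS"
    and "left_shelf trT"
    and "matched_product_system (shelf_solution trS) (shelf_solution trT) \<alpha> \<beta>"
  shows "\<forall>a b u v.
    structure_shelf (matched_product (shelf_solution trS) (shelf_solution trT) \<alpha> \<beta>) (a, u) (b, v)
      = (trS a b, trT u v)"
proof -
  interpret matched_product_system "shelf_solution trS" "shelf_solution trT" \<alpha> \<beta>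
    by (rule assms(3))
  show ?thesis
    by (simp add: structure_shelf_matched_product_trivial_lam lam_shelf_solution rho_shelf_solution)
qed

end
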